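(* Let $k\ge 1$, let $A\in\{0,1\}^{k\times k}$ be a primitive matrix, and let $p\in\partial\Sigma_G^{\ast}$ be any ray of the golden-mean tree $\Sigma_G^{\ast}$, where $G=\begin{bmatrix}1&1\\1&0\end{bmatrix}$. Let $\mathcal{T}_A$ be the Markov hom tree-shift on $\Sigma_G^{\ast}$ associated with $A$. Then $$\lim_{n\to\infty}h^{n}(\mathcal{T}_A,p)=h(\mathcal{T}_A),$$ where $h^n(\mathcal{T}_A,p)$ is the $n$-strip entropy of $\mathcal{T}_A$ along $p$ and $h(\mathcal{T}_A)$ is the entropy of $\mathcal{T}_A$.
   Context: Golden-mean tree. Let $\Sigma=\{f_1,f_2\}$, with the rows and columns of $G$ indexed by $f_1,f_2$ in this order. For $n\ge 0$, $\Sigma_G^{n}$ is the set of words $\omega=(\omega_1,\ldots,\omega_n)$ over $\Sigma$ of length $n$ with $G(\omega_i,\omega_{i+1})=1$ for $1\le i\le n-1$ (that is, $f_2$ is never followed by $f_2$); $\Sigma_G^0=\{\epsilon\}$ with $\epsilon$ the empty word. The golden-mean tree is $\Sigma_G^{\ast}=\bigcup_{n\ge 0}\Sigma_G^n$, with root $\epsilon$; the length of a word $\omega$ is denoted $|\omega|$. Put $\Delta_n=\bigcup_{i=0}^n\Sigma_G^i$. Rays. The boundary $\partial\Sigma_G^{\ast}$ is the set of all rays $p=(p_0,p_1,p_2,\ldots)$ with $p_0=\epsilon$ and $p_n=f_{i_1}f_{i_2}\cdots f_{i_n}\in\Sigma_G^n$ for all $n\ge1$, for some infinite sequence of letters $f_{i_1},f_{i_2},\ldots$.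 Tree-shift. Let $\mathcal{A}=\{1,\ldots,k\}$. The Markov hom tree-shift is $$\mathcal{T}_A=\{t\in\mathcal{A}^{\Sigma_G^{\ast}}: A(t_\omega,t_{\omega f})=1\text{ for all }\omega\in\Sigma_G^{\ast},\ f\in\Sigma\text{ with }\omega f\in\Sigma_G^{\ast}\}.$$ For finite $F\subseteq\Sigma_G^{\ast}$, $\mathcal{P}(F,\mathcal{T}_A)=\{(t_\omega)_{\omega\in F}: t\in\mathcal{T}_A\}\subseteq\mathcal{A}^F$. Entropy. $h(\mathcal{T}_A)=\lim_{n\to\infty}\dfrac{\log|\mathcal{P}(\Delta_n,\mathcal{T}_A)|}{|\Delta_n|}$ (the existence of this limit is taken as known). Strip entropy. For a ray $p=(p_0,p_1,p_2,\ldots)\in\partial\Sigma_G^{\ast}$, $n\ge 1$ and $j\ge 0$, let $$\Lambda^n(p_j)=\{p_j\omega\in\Sigma_G^{\ast}: |p_j\omega|\le j+n-1,\ \text{and either }\omega=\epsilon\text{ or the first letter }\omega_1\text{ of }\omega\text{ satisfies }p_j\omega_1\neq p_{j+1}\},$$ for $m\ge 1$ let $\Lambda^n_m(p)=\bigcup_{j=0}^{m-1}\Lambda^n(p_j)$, and define $$h^n(\mathcal{T}_A,p)=\limsup_{m\to\infty}\frac{\log|\mathcal{P}(\Lambda_m^n(p),\mathcal{T}_A)|}{|\Lambda_m^n(p)|}.$$ A nonnegative square matrix is primitive if some power of it has all entries strictly positive. *)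

theory Defs
  imports "HOL-Analysis.Analysis"
begin

(* The letters f_1, f_2 are the elements 1, 2 of the two-element type 2,
   so words are lists over that type. *)

definition golden_matrix :: "real ^ 2 ^ 2" where
  "golden_matrix = vector [vector [1, 1], vector [1, 0]]"

definition words :: "nat \<Rightarrow> 2 list set" where
  "words n = {w. length w = n \<and> successively (\<lambda>a b. golden_matrix $ a $ b = 1) w}"

definition golden_tree :: "2 list set" where
  "golden_tree = (\<Union>n. words n)"

definition Delta :: "nat \<Rightarrow> 2 list set" where
  "Delta n = (\<Union>i\<le>n. words i)"

definition rays :: "(nat \<Rightarrow> 2 list) set" where
  "rays = {p. p 0 = [] \<and>
     (\<exists>s :: nat \<Rightarrow> 2. \<forall>n\<ge>1. p n = map s [1..<Suc n] \<and> p n \<in> words n)}"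

primrec matrix_power :: "real ^ 'k ^ 'k \<Rightarrow> nat \<Rightarrow> real ^ 'k ^ 'k" where
  "matrix_power A 0 = mat 1"
| "matrix_power A (Suc n) = matrix_power A n ** A"

(* The exponent must be positive: otherwise the 1 x 1 zero matrix would count as primitive,
   its zeroth power being the identity. *)
definition primitive_matrix :: "real ^ 'k ^ 'k \<Rightarrow> bool" where
  "primitive_matrix A \<longleftrightarrow> (\<forall>i j. 0 \<le> A $ i $ j) \<and>
     (\<exists>N\<ge>1. \<forall>i j. 0 < matrix_power A N $ i $ j)"

(* The alphabet {1, ..., k} is the finite index type 'k of the matrix, k = CARD('k).
   Labelings live on the tree only, so they are extensional functions. *)
definition tree_shift :: "real ^ 'k ^ 'k \<Rightarrow> (2 list \<Rightarrow> 'k) set" where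
  "tree_shift A = {t \<in> golden_tree \<rightarrow>\<^sub>E UNIV.
     \<forall>w\<in>golden_tree. \<forall>f. w @ [f] \<in> golden_tree \<longrightarrow> A $ t w $ t (w @ [f]) = 1}"

definition patterns :: "2 list set \<Rightarrow> (2 list \<Rightarrow> 'k) set \<Rightarrow> (2 list \<Rightarrow> 'k) set" where
  "patterns F T = (\<lambda>t. restrict t F) ` T"

definition entropy :: "(2 list \<Rightarrow> 'k) set \<Rightarrow> real" where
  "entropy T = lim (\<lambda>n. ln (real (card (patterns (Delta n) T))) / real (card (Delta n)))"

(* The set of the p_j w which branch off the ray p at p_j, only meaningful for n \<ge> 1. *)
definition strip_part :: "nat \<Rightarrow> (nat \<Rightarrow> 2 list) \<Rightarrow> nat \<Rightarrow> 2 list set" where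
  "strip_part n p j = {p j @ w | w. p j @ w \<in> golden_tree \<and> length (p j @ w) \<le> j + n - 1 \<and>
     (w = [] \<or> p j @ [hd w] \<noteq> p (Suc j))}"

definition strip :: "nat \<Rightarrow> nat \<Rightarrow> (nat \<Rightarrow> 2 list) \<Rightarrow> 2 list set" where
  "strip n m p = (\<Union>j<m. strip_part n p j)"

(* Extended reals, because limsup needs a complete lattice. *)
definition strip_entropy :: "nat \<Rightarrow> (2 list \<Rightarrow> 'k) set \<Rightarrow> (nat \<Rightarrow> 2 list) \<Rightarrow> ereal" where
  "strip_entropy n T p =
     limsup (\<lambda>m. ereal (ln (real (card (patterns (strip n m p) T))) / real (card (strip n m p))))"

end

theory Submission
  imports Defs "HOL-Library.Sublist" "HOL-Real_Asymp.Real_Asymp"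
begin

text \<open>
  Why the theorem is true. Below a node of the golden-mean tree the subtree looks the same for all
  nodes ending in \<open>f\<^sub>1\<close> and for the root, and the same for all nodes ending in \<open>f\<^sub>2\<close>. Write
  \<open>x n a\<close> and \<open>y n a\<close> for the number of admissible labelings of these two kinds of branches of
  depth \<open>n\<close> whose root has label \<open>a\<close> (\<open>branch_count\<close>), and \<open>\<phi>\<close> for the golden ratio. The number
  of nodes of a branch grows like \<open>\<phi> ^ n\<close>.

  The heart of the proof is that \<open>ln (x n a)\<close> and \<open>ln (y n a)\<close>, divided by the number of nodes of
  the branch, tend to the same limit \<open>h\<close> for every label \<open>a\<close> and both kinds of branches
  (\<open>branch_entropy\<close>). This has two parts.

  \<^item> The maximum of \<open>x n\<close> over all labels is Fibonacci-submultiplicative up to a constant factor,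
    so its logarithm divided by \<open>\<phi> ^ n\<close> converges to some \<open>H\<close>
    (\<open>fibonacci_subadditive_convergent\<close>).

  \<^item> Let \<open>a \<rightarrow> b\<close> be an allowed transition. Then \<open>x (n + 1) a \<ge> x n b * y n b\<close>. Moreover
    \<open>x n b\<close> is \<open>y n b\<close> times the number of continuations below the second child, which is at
    most a constant times the maximum of \<open>x (n - 2)\<close>. Hence \<open>x (n + 1) a\<close> is at least a constant
    times \<open>(x n b)\<^sup>2 / max x (n - 2)\<close>. Since \<open>2 * \<phi> ^ n - \<phi> ^ (n - 2) = \<phi> ^ (n + 1)\<close>, the
    property of growing at the maximal rate \<open>H\<close> passes from \<open>b\<close> to \<open>a\<close> (\<open>growth_step\<close>). By
    primitivity, every label reaches the maximising label of every depth along a path of one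
    common length, so every label grows at the maximal rate.

  Summing over the label of the root shows that \<open>h\<close> is the entropy of the tree-shift
  (\<open>entropy_eq\<close>). A strip consists of the nodes of the ray together with at most one branch
  hanging off each of them, and a labeling of it is a labeling of the ray together with compatible
  labelings of the branches. So the logarithm of the number of patterns differs from \<open>h\<close> times the
  number of nodes only by a small multiple of the number of nodes, caused by the branches, and by a
  constant for each node of the ray (\<open>rooted_segment_close\<close>). A ray node without side branch ends
  in \<open>f\<^sub>2\<close>, so no two such nodes are adjacent, and on average a ray node carries at least half a
  branch (\<open>segment_large\<close>). The second error, divided by the number of nodes, is therefore of order
  \<open>1 / n\<close>, uniformly in the length of the strip.
\<close>

section \<open>Golden-mean words\<close>

lemma golden_matrix_eq_1: "golden_matrix $ a $ b = 1 \<longleftrightarrow> \<not> (a = 2 \<and> b = 2)"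
  using exhaust_2[of a] exhaust_2[of b] by (auto simp: golden_matrix_def)

text \<open>
  The root has the same two children as a node ending in \<open>f\<^sub>1\<close>, so it is given that type.
\<close>
definition node_type :: "2 list \<Rightarrow> 2" where
  "node_type w = (if w = [] then 1 else last w)"

lemma node_type_snoc [simp]: "node_type (w @ [f]) = f"
  by (simp add: node_type_def)

lemma golden_tree_iff: "w \<in> golden_tree \<longleftrightarrow> successively (\<lambda>a b. golden_matrix $ a $ b = 1) w"
  by (auto simp: golden_tree_def words_def)

lemma golden_tree_snoc:
  "w @ [f] \<in> golden_tree \<longleftrightarrow> w \<in> golden_tree \<and> golden_matrix $ node_type w $ f = 1"
  by (auto simp: golden_tree_iff successively_append_iff node_type_def golden_matrix_eq_1)

lemma golden_tree_prefix: "prefix v w \<Longrightarrow> w \<in> golden_tree \<Longrightarrow> v \<in> golden_tree"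
  by (auto simp: golden_tree_iff successively_append_iff prefix_def)

lemma Nil_in_golden_tree [simp]: "[] \<in> golden_tree"
  by (simp add: golden_tree_iff)

definition subtree :: "nat \<Rightarrow> 2 list \<Rightarrow> 2 list set" where
  "subtree n w = {v \<in> golden_tree. prefix w v \<and> length v \<le> length w + n}"

lemma finite_subtree [simp]: "finite (subtree n w)"
proof (rule finite_subset)
  show "subtree n w \<subseteq> {v. set v \<subseteq> UNIV \<and> length v \<le> length w + n}"
    by (auto simp: subtree_def)
  show "finite {v :: 2 list. set v \<subseteq> UNIV \<and> length v \<le> length w + n}"
    by (rule finite_lists_length_le) simp
qed

lemma subtree_empty: "w \<notin> golden_tree \<Longrightarrow> subtree n w = {}"
  using golden_tree_prefix by (auto simp: subtree_def)

lemma root_in_subtree: "w \<in> golden_tree \<Longrightarrow> w \<in> subtree n w"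
  by (simp add: subtree_def)

lemma subtree_prefix: "v \<in> subtree n w \<Longrightarrow> prefix w v"
  by (simp add: subtree_def)

lemma subtree_0: "w \<in> golden_tree \<Longrightarrow> subtree 0 w = {w}"
  by (auto simp: subtree_def prefix_def)

lemma prefix_proper_iff: "prefix w v \<and> v \<noteq> w \<longleftrightarrow> (\<exists>f. prefix (w @ [f]) v)"
proof
  assume "prefix w v \<and> v \<noteq> w"
  then obtain z where "v = w @ z" "z \<noteq> []" by (auto simp: prefix_def)
  then show "\<exists>f. prefix (w @ [f]) v" by (cases z) (auto simp: prefix_def)
qed (auto simp: prefix_def)

lemma subtree_Suc:
  assumes "w \<in> golden_tree"
  shows "subtree (Suc n) w = insert w (\<Union>f. subtree n (w @ [f]))"
proof -
  have "v \<in> subtree (Suc n) w \<longleftrightarrow> v = w \<or> (\<exists>f. v \<in> subtree n (w @ [f]))" for v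
    using prefix_proper_iff[of w v] assms by (auto simp: subtree_def)
  then show ?thesis by auto
qed

lemma Delta_eq_subtree: "Delta n = subtree n []"
  by (auto simp: Delta_def subtree_def words_def golden_tree_iff)

section \<open>Counting labelings\<close>

definition labelings :: "real ^ 'k ^ 'k \<Rightarrow> 2 list set \<Rightarrow> (2 list \<Rightarrow> 'k) set" where
  "labelings A F = {t \<in> F \<rightarrow>\<^sub>E UNIV.
     \<forall>w f. w \<in> F \<longrightarrow> w @ [f] \<in> F \<longrightarrow> A $ t w $ t (w @ [f]) = 1}"

definition rooted :: "real ^ 'k ^ 'k \<Rightarrow> 2 list set \<Rightarrow> 2 list \<Rightarrow> 'k \<Rightarrow> nat" where
  "rooted A F w a = card {t \<in> labelings A F. t w = a}"

lemma finite_labelings: "finite F \<Longrightarrow> finite (labelings (A :: real ^ 'k ^ 'k) F)"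
  by (rule finite_subset[of _ "F \<rightarrow>\<^sub>E UNIV"]) (auto simp: labelings_def intro: finite_PiE)

lemma rooted_singleton: "rooted A {w} w a = 1"
proof -
  have "{t \<in> labelings A {w}. t w = a} = {\<lambda>v\<in>{w}. a}"
    by (auto simp: labelings_def fun_eq_iff PiE_def extensional_def)
  then show ?thesis by (simp add: rooted_def)
qed

lemma card_labelings:
  assumes "finite F"
  shows "card (labelings A F) = (\<Sum>a\<in>UNIV. rooted A F w a)"
proof -
  have "labelings A F = (\<Union>a. {t \<in> labelings A F. t w = a})" by auto
  also have "card \<dots> = (\<Sum>a\<in>UNIV. rooted A F w a)"
    unfolding rooted_def
    by (rule card_UN_disjoint) (auto intro: finite_subset[OF _ finite_labelings[OF assms, of A]])
  finally show ?thesis .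
qed

text \<open>
  Counting labelings one edge at a time: if \<open>C\<close> hangs off \<open>B\<close> by the single edge from \<open>w\<close> to
  \<open>w @ [f]\<close>, then labelings of the two parts are independent apart from the transition along that
  edge. The two conditions on prefixes ensure that there is no other edge; they hold both for the
  children of a node and for successive pieces of a strip.
\<close>
lemma rooted_glue:
  fixes A :: "real ^ 'k ^ 'k"
  assumes fin: "finite B" "finite C"
    and A01: "\<forall>i j. A $ i $ j \<in> {0, 1}"
    and w: "w \<in> B" and u: "w @ [f] \<in> C"
    and B: "\<And>v. v \<in> B \<Longrightarrow> \<not> prefix (w @ [f]) v"
    and C: "\<And>v. v \<in> C \<Longrightarrow> prefix (w @ [f]) v"
  shows "real (rooted A (B \<union> C) w a)
    = real (rooted A B w a) * (\<Sum>b\<in>UNIV. A $ a $ b * real (rooted A C (w @ [f]) b))"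
proof -
  let ?u = "w @ [f]"
  let ?R = "\<Union>b\<in>{b. A $ a $ b = 1}. {t \<in> labelings A C. t ?u = b}"
  have BC: "v \<notin> C" if "v \<in> B" for v using B C that by blast
  \<comment> \<open>the edge above \<open>?u\<close> is the only one between the two parts\<close>
  have e1: "v = w \<and> g = f" if "v \<in> B" "v @ [g] \<in> C" for v g
    using B[OF that(1)] C[OF that(2)] by (simp add: prefix_snoc)
  have e2: "v @ [g] \<notin> B" if "v \<in> C" for v g
    using B[of "v @ [g]"] C[OF that] by (auto simp: prefix_snoc)
  have "bij_betw (\<lambda>t. (restrict t B, restrict t C))
      {t \<in> labelings A (B \<union> C). t w = a} ({t \<in> labelings A B. t w = a} \<times> ?R)"
  proof (rule bij_betwI[where g = "\<lambda>(s, r) v. if v \<in> B then s v else r v"])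
    show "(\<lambda>t. (restrict t B, restrict t C)) \<in> {t \<in> labelings A (B \<union> C). t w = a}
        \<rightarrow> {t \<in> labelings A B. t w = a} \<times> ?R"
      using w u by (auto simp: labelings_def)
    show "(\<lambda>(s, r) v. if v \<in> B then s v else r v) \<in> {t \<in> labelings A B. t w = a} \<times> ?R
        \<rightarrow> {t \<in> labelings A (B \<union> C). t w = a}"
    proof (clarify, intro CollectI conjI)
      fix s r
      assume s: "s \<in> labelings A B" and a: "a = s w"
        and r: "r \<in> labelings A C" and ar: "A $ s w $ r ?u = 1"
      let ?t = "\<lambda>v. if v \<in> B then s v else r v"
      have "A $ ?t v $ ?t (v @ [g]) = 1" if "v \<in> B \<union> C" "v @ [g] \<in> B \<union> C" for v g
      proof (cases "v \<in> B")
        case True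
        show ?thesis
        proof (cases "v @ [g] \<in> B")
          case True
          then show ?thesis using s \<open>v \<in> B\<close> by (simp add: labelings_def)
        next
          case False
          then have "v = w" "g = f" using e1[OF \<open>v \<in> B\<close>, of g] that(2) by auto
          then show ?thesis using ar w False by simp
        qed
      next
        case False
        then have "v \<in> C" using that(1) by simp
        then have "v @ [g] \<in> C" "v @ [g] \<notin> B" using e2 that(2) by auto
        then show ?thesis using r \<open>v \<in> C\<close> False by (simp add: labelings_def)
      qed
      moreover have "?t \<in> B \<union> C \<rightarrow>\<^sub>E UNIV"
        using r by (auto simp: labelings_def PiE_def extensional_def)
      ultimately show "?t \<in> labelings A (B \<union> C)"
        unfolding labelings_def by blast
      show "?t w = s w" using w by simp
    qed
    show "(\<lambda>(s, r) v. if v \<in> B then s v else r v) (restrict t B, restrict t C) = t"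
      if "t \<in> {t \<in> labelings A (B \<union> C). t w = a}" for t
      using that by (auto simp: labelings_def fun_eq_iff PiE_def extensional_def)
    show "(\<lambda>t. (restrict t B, restrict t C)) ((\<lambda>(s, r) v. if v \<in> B then s v else r v) y) = y"
      if "y \<in> {t \<in> labelings A B. t w = a} \<times> ?R" for y
      using that BC by (auto simp: labelings_def fun_eq_iff PiE_def extensional_def)
  qed
  then have "rooted A (B \<union> C) w a = rooted A B w a * card ?R"
    by (simp add: rooted_def bij_betw_same_card card_cartesian_product)
  also have "card ?R = (\<Sum>b\<in>{b. A $ a $ b = 1}. rooted A C ?u b)"
    unfolding rooted_def
    by (rule card_UN_disjoint) (auto intro: finite_subset[OF _ finite_labelings[OF fin(2), of A]])
  also have "real (rooted A B w a * \<dots>)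
      = real (rooted A B w a) * (\<Sum>b\<in>{b. A $ a $ b = 1}. real (rooted A C ?u b))"
    by simp
  also have "(\<Sum>b\<in>{b. A $ a $ b = 1}. real (rooted A C ?u b))
      = (\<Sum>b\<in>UNIV. A $ a $ b * real (rooted A C ?u b))"
  proof (rule sum.mono_neutral_cong_left)
    show "\<forall>b\<in>UNIV - {b. A $ a $ b = 1}. A $ a $ b * real (rooted A C ?u b) = 0"
      using A01 by auto
  qed auto
  finally show ?thesis .
qed

text \<open>
  The argument is the reversed word, so that the recursion goes from a node to its parent. At
  the root the value is that of \<open>s\<close>, since the sets \<open>F\<close> of interest contain the root.
\<close>
primrec extend_labeling :: "2 list set \<Rightarrow> (2 list \<Rightarrow> 'k) \<Rightarrow> ('k \<Rightarrow> 'k) \<Rightarrow> 2 list \<Rightarrow> 'k" where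
  "extend_labeling F s c [] = s []"
| "extend_labeling F s c (f # r) =
    (if rev (f # r) \<in> F then s (rev (f # r)) else c (extend_labeling F s c r))"

text \<open>
  Admissibility of a pattern is a local condition: as every label has a successor, an admissible
  labeling of a set closed under parents extends to the whole tree by choosing labels downwards.
\<close>
lemma patterns_eq_labelings:
  fixes A :: "real ^ 'k ^ 'k"
  assumes succ: "\<And>a. \<exists>b. A $ a $ b = 1"
    and F: "F \<subseteq> golden_tree" "[] \<in> F" "\<And>w f. w @ [f] \<in> F \<Longrightarrow> w \<in> F"
  shows "patterns F (tree_shift A) = labelings A F"
proof
  show "patterns F (tree_shift A) \<subseteq> labelings A F"
  proof
    fix s assume "s \<in> patterns F (tree_shift A)"
    then obtain t where t: "t \<in> tree_shift A" "s = restrict t F" by (auto simp: patterns_def)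
    have "A $ t w $ t (w @ [f]) = 1" if "w \<in> F" "w @ [f] \<in> F" for w f
      using t(1) subsetD[OF F(1) that(1)] subsetD[OF F(1) that(2)] by (simp add: tree_shift_def)
    then show "s \<in> labelings A F" by (auto simp: labelings_def t(2))
  qed
  show "labelings A F \<subseteq> patterns F (tree_shift A)"
  proof
    fix s assume s: "s \<in> labelings A F"
    obtain c where c: "\<And>a. A $ a $ c a = 1" using succ by metis
    define e where "e w = extend_labeling F s c (rev w)" for w
    have e_F: "e w = s w" if "w \<in> F" for w
      using that by (cases "rev w") (auto simp: e_def)
    have e_edge: "A $ e w $ e (w @ [f]) = 1" for w f
    proof (cases "w @ [f] \<in> F")
      case True
      then show ?thesis using s F(3)[OF True] by (simp add: e_F labelings_def)
    next
      case False
      then show ?thesis by (simp add: e_def c)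
    qed
    have "restrict e golden_tree \<in> tree_shift A"
      by (auto simp: tree_shift_def e_edge golden_tree_snoc)
    moreover have "restrict (restrict e golden_tree) F = s"
      using s F(1) e_F by (auto simp: labelings_def fun_eq_iff PiE_def extensional_def)
    ultimately show "s \<in> patterns F (tree_shift A)"
      unfolding patterns_def by (metis imageI)
  qed
qed

text \<open>
  The second argument is the type of the root of the branch, that is, \<open>f\<^sub>1\<close> or \<open>f\<^sub>2\<close>.
\<close>
primrec branch_count :: "real ^ 'k ^ 'k \<Rightarrow> nat \<Rightarrow> 2 \<Rightarrow> 'k \<Rightarrow> real" where
  "branch_count A 0 f a = 1"
| "branch_count A (Suc n) f a =
    (\<Prod>g\<in>{g. golden_matrix $ f $ g = 1}. \<Sum>b\<in>UNIV. A $ a $ b * branch_count A n g b)"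

primrec branch_size :: "nat \<Rightarrow> 2 \<Rightarrow> nat" where
  "branch_size 0 f = 1"
| "branch_size (Suc n) f = 1 + (\<Sum>g\<in>{g. golden_matrix $ f $ g = 1}. branch_size n g)"

lemma golden_row: "{g. golden_matrix $ 1 $ g = 1} = {1, 2}" "{g. golden_matrix $ 2 $ g = 1} = {1}"
  using exhaust_2 by (auto simp: golden_matrix_eq_1)

lemma rooted_insert:
  assumes "\<forall>i j. A $ i $ j \<in> {0, 1}" "w @ [f] \<in> golden_tree"
    and "\<And>b. real (rooted A (subtree n (w @ [f])) (w @ [f]) b) = branch_count A n f b"
  shows "real (rooted A (insert w (subtree n (w @ [f]))) w a)
    = (\<Sum>b\<in>UNIV. A $ a $ b * branch_count A n f b)"
  using rooted_glue[of "{w}" "subtree n (w @ [f])" A w f a] assms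
  by (simp add: rooted_singleton root_in_subtree subtree_prefix)

lemma rooted_subtree:
  fixes A :: "real ^ 'k ^ 'k"
  assumes A01: "\<forall>i j. A $ i $ j \<in> {0, 1}"
  shows "w \<in> golden_tree \<Longrightarrow> real (rooted A (subtree n w) w a) = branch_count A n (node_type w) a"
proof (induction n arbitrary: w a)
  case 0
  then show ?case by (simp add: subtree_0 rooted_singleton)
next
  case (Suc n)
  have IH: "real (rooted A (subtree n (w @ [f])) (w @ [f]) b) = branch_count A n f b"
    if "w @ [f] \<in> golden_tree" for f b
    using Suc.IH[OF that] by simp
  have w1: "w @ [1] \<in> golden_tree"
    using Suc.prems by (simp add: golden_tree_snoc golden_matrix_eq_1)
  have eq: "subtree (Suc n) w = insert w (subtree n (w @ [1])) \<union> subtree n (w @ [2])"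
    using subtree_Suc[OF Suc.prems, of n] by (simp add: UNIV_2)
  show ?case
  proof (cases "w @ [2] \<in> golden_tree")
    case True
    have "node_type w = 1"
      using True exhaust_2[of "node_type w"] by (auto simp: golden_tree_snoc golden_matrix_eq_1)
    moreover have "real (rooted A (subtree (Suc n) w) w a)
        = real (rooted A (insert w (subtree n (w @ [1]))) w a)
          * (\<Sum>b\<in>UNIV. A $ a $ b * real (rooted A (subtree n (w @ [2])) (w @ [2]) b))"
      unfolding eq
    proof (rule rooted_glue)
      show "\<not> prefix (w @ [2]) v" if "v \<in> insert w (subtree n (w @ [1]))" for v
        using that by (auto simp: subtree_def prefix_def)
    qed (use A01 True root_in_subtree subtree_prefix in auto)
    ultimately show ?thesis
      using rooted_insert[OF A01 w1 IH[OF w1]] IH[OF True] by (simp add: golden_row)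
  next
    case False
    then have "node_type w = 2"
      using Suc.prems by (auto simp: golden_tree_snoc golden_matrix_eq_1)
    then show ?thesis
      using rooted_insert[OF A01 w1 IH[OF w1]] False by (simp add: golden_row eq subtree_empty)
  qed
qed

lemma card_subtree: "w \<in> golden_tree \<Longrightarrow> card (subtree n w) = branch_size n (node_type w)"
proof (induction n arbitrary: w)
  case 0
  then show ?case by (simp add: subtree_0)
next
  case (Suc n)
  let ?G = "{f. golden_matrix $ node_type w $ f = 1}"
  have "subtree (Suc n) w = insert w (\<Union>f\<in>?G. subtree n (w @ [f]))"
  proof -
    have "subtree n (w @ [f]) = {}" if "f \<notin> ?G" for f
      using that subtree_empty by (simp add: golden_tree_snoc)
    then show ?thesis unfolding subtree_Suc[OF Suc.prems] by blast
  qed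
  moreover have "w \<notin> (\<Union>f\<in>?G. subtree n (w @ [f]))"
    by (auto simp: subtree_def prefix_def)
  moreover have "card (\<Union>f\<in>?G. subtree n (w @ [f])) = (\<Sum>f\<in>?G. card (subtree n (w @ [f])))"
    by (rule card_UN_disjoint) (simp, simp, auto simp: subtree_def prefix_def)
  moreover have "card (subtree n (w @ [f])) = branch_size n f" if "f \<in> ?G" for f
    using Suc.IH[of "w @ [f]"] Suc.prems that by (simp add: golden_tree_snoc)
  ultimately show ?case by simp
qed

section \<open>Fibonacci-subadditive sequences\<close>

definition golden_ratio :: real where
  "golden_ratio = (1 + sqrt 5) / 2"

lemma golden_ratio_gt_1: "golden_ratio > 1"
proof -
  have "sqrt 5 > sqrt 1" by (rule real_sqrt_less_mono) simp
  then show ?thesis by (simp add: golden_ratio_def)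
qed

lemma golden_ratio_square: "golden_ratio\<^sup>2 = golden_ratio + 1"
  by (simp add: golden_ratio_def power2_eq_square field_simps)

lemma golden_ratio_power: "golden_ratio ^ (n + 2) = golden_ratio ^ (n + 1) + golden_ratio ^ n"
proof -
  have "golden_ratio ^ (n + 2) = golden_ratio ^ n * golden_ratio\<^sup>2" by (rule power_add)
  then show ?thesis by (simp add: golden_ratio_square distrib_left)
qed

lemma over_golden_power_tendsto_0: "(\<lambda>n. c / golden_ratio ^ n) \<longlonglongrightarrow> 0"
  using tendsto_mult[OF tendsto_const LIMSEQ_inverse_realpow_zero[OF golden_ratio_gt_1], of c]
  by (simp add: divide_inverse)

text \<open>
  The distance of \<open>r n\<close> from the fixed point \<open>L / (1 + q)\<close> is contracted by \<open>q\<close> in each step, up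
  to an error that tends to 0.
\<close>
lemma tendsto_of_affine_recurrence:
  fixes r :: "nat \<Rightarrow> real"
  assumes q: "0 \<le> q" "q < 1" and lim: "(\<lambda>n. r (Suc n) + q * r n) \<longlonglongrightarrow> L"
  shows "r \<longlonglongrightarrow> L / (1 + q)"
proof -
  define z where "z n = r n - L / (1 + q)" for n
  define e where "e n = z (Suc n) + q * z n" for n
  have e_eq: "e n = (r (Suc n) + q * r n) - L" for n
  proof -
    have "L / (1 + q) + q * (L / (1 + q)) = (1 + q) * (L / (1 + q))"
      by (simp only: distrib_right mult_1)
    also have "\<dots> = L" using q by simp
    finally have "L / (1 + q) + q * (L / (1 + q)) = L" .
    then show ?thesis by (simp add: e_def z_def algebra_simps)
  qed
  have "e \<longlonglongrightarrow> 0"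
    using lim unfolding e_eq by (simp add: LIM_zero)
  have "z \<longlonglongrightarrow> 0"
  proof (rule LIMSEQ_I)
    fix \<epsilon> :: real assume \<epsilon>: "\<epsilon> > 0"
    then have "\<epsilon> / 2 * (1 - q) > 0" using q by simp
    then obtain N where N: "\<And>n. n \<ge> N \<Longrightarrow> \<bar>e n\<bar> < \<epsilon> / 2 * (1 - q)"
      using LIMSEQ_D[OF \<open>e \<longlonglongrightarrow> 0\<close>] by (metis diff_zero real_norm_def)
    have bound: "\<bar>z (N + j)\<bar> \<le> q ^ j * \<bar>z N\<bar> + \<epsilon> / 2" for j
    proof (induction j)
      case 0
      then show ?case using \<epsilon> by simp
    next
      case (Suc j)
      have "\<bar>z (N + Suc j)\<bar> \<le> q * \<bar>z (N + j)\<bar> + \<bar>e (N + j)\<bar>"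
      proof -
        have "z (N + Suc j) = e (N + j) - q * z (N + j)" by (simp add: e_def)
        moreover have "\<bar>q * z (N + j)\<bar> = q * \<bar>z (N + j)\<bar>" using q by (simp add: abs_mult)
        ultimately show ?thesis by linarith
      qed
      also have "\<dots> \<le> q * (q ^ j * \<bar>z N\<bar> + \<epsilon> / 2) + \<epsilon> / 2 * (1 - q)"
        using N[of "N + j"] Suc q by (intro add_mono mult_left_mono) auto
      also have "\<dots> = q ^ Suc j * \<bar>z N\<bar> + \<epsilon> / 2"
        by (simp add: right_diff_distrib distrib_left)
      finally show ?case .
    qed
    have "(\<lambda>j. q ^ j * \<bar>z N\<bar>) \<longlonglongrightarrow> 0 * \<bar>z N\<bar>"
      by (intro tendsto_mult tendsto_const LIMSEQ_realpow_zero q)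
    then have "eventually (\<lambda>j. q ^ j * \<bar>z N\<bar> < \<epsilon> / 2) sequentially"
      by (rule order_tendstoD(2)) (use \<epsilon> in simp)
    then obtain J where J: "\<And>j. j \<ge> J \<Longrightarrow> q ^ j * \<bar>z N\<bar> < \<epsilon> / 2"
      by (auto simp: eventually_sequentially)
    have "norm (z n - 0) < \<epsilon>" if "n \<ge> N + J" for n
    proof -
      have "J \<le> n - N" "N + (n - N) = n" using that by simp_all
      then show ?thesis using bound[of "n - N"] J[of "n - N"] by simp
    qed
    then show "\<exists>no. \<forall>n\<ge>no. norm (z n - 0) < \<epsilon>" by blast
  qed
  then have "(\<lambda>n. r n - L / (1 + q)) \<longlonglongrightarrow> 0" by (simp only: z_def[abs_def])
  then show ?thesis by (rule LIM_zero_cancel)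
qed

text \<open>
  A two-step analogue of Fekete's lemma. The ratio \<open>r n = Q n / \<phi> ^ n\<close> need not be monotone, but
  \<open>r (n + 1) + r n / \<phi>\<^sup>2\<close> is decreasing: the recurrence bounds \<open>r (n + 2)\<close> by the mean of
  \<open>r (n + 1)\<close> and \<open>r n\<close> with weights \<open>1 / \<phi>\<close> and \<open>1 / \<phi>\<^sup>2\<close>, whose sum is 1.
\<close>
lemma fibonacci_subadditive_convergent:
  fixes Q :: "nat \<Rightarrow> real"
  assumes nonneg: "\<And>n. 0 \<le> Q n" and sub: "\<And>n. Q (n + 2) \<le> Q (n + 1) + Q n"
  shows "convergent (\<lambda>n. Q n / golden_ratio ^ n)"
proof -
  note gr = golden_ratio_gt_1
  define r where "r n = Q n / golden_ratio ^ n" for n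
  define q where "q = 1 / golden_ratio\<^sup>2"
  have q: "0 \<le> q" "q < 1" using gr by (simp_all add: q_def power2_eq_square less_1_mult)
  have r_nonneg: "0 \<le> r n" for n using nonneg gr by (simp add: r_def)
  have "decseq (\<lambda>n. r (Suc n) + q * r n)"
  proof (rule decseq_SucI)
    fix n
    have "r (n + 2) \<le> (Q (n + 1) + Q n) / golden_ratio ^ (n + 2)"
      unfolding r_def using sub[of n] gr by (intro divide_right_mono) auto
    also have "\<dots> = r (Suc n) / golden_ratio + q * r n"
      using gr by (simp add: r_def q_def field_simps power2_eq_square)
    also have "r (Suc n) / golden_ratio = r (Suc n) * (1 - q)"
    proof -
      have "1 / golden_ratio = 1 - q"
        using gr golden_ratio_square by (simp add: q_def power2_eq_square field_simps)
      then show ?thesis by (metis mult.right_neutral times_divide_eq_right)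
    qed
    finally show "r (Suc (Suc n)) + q * r (Suc n) \<le> r (Suc n) + q * r n"
      by (simp add: algebra_simps)
  qed
  moreover have "\<forall>n. 0 \<le> r (Suc n) + q * r n"
    using r_nonneg q by simp
  ultimately obtain L where "(\<lambda>n. r (Suc n) + q * r n) \<longlonglongrightarrow> L"
    by (rule decseq_convergent)
  then have "r \<longlonglongrightarrow> L / (1 + q)" by (rule tendsto_of_affine_recurrence[OF q])
  then show ?thesis unfolding r_def convergent_def by blast
qed

section \<open>Growth of branches\<close>

lemma branch_size_Suc:
  "branch_size (Suc n) 1 = 1 + branch_size n 1 + branch_size n 2"
  "branch_size (Suc n) 2 = 1 + branch_size n 1"
  by (simp_all add: golden_row)

declare branch_size.simps(2) [simp del] branch_count.simps(2) [simp del]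

lemma branch_size_ge: "branch_size n f \<ge> n + 1"
proof (induction n arbitrary: f)
  case (Suc n)
  have "branch_size (Suc n) f \<ge> 1 + branch_size n 1"
    using exhaust_2[of f] by (auto simp: branch_size_Suc)
  then show ?case using Suc[of 1] by simp
qed simp

text \<open>
  Adding 2 to the size of a branch turns its recurrence into the Fibonacci recurrence.
\<close>
lemma branch_size_asymptotic:
  obtains \<kappa> where "\<kappa> > 0" "(\<lambda>n. real (branch_size n 1) / golden_ratio ^ n) \<longlonglongrightarrow> \<kappa>"
proof -
  define V where "V n = real (branch_size n 1) + 2" for n
  have rec: "V (n + 2) = V (n + 1) + V n" for n
    by (simp add: V_def branch_size_Suc)
  have "convergent (\<lambda>n. V n / golden_ratio ^ n)"
    by (rule fibonacci_subadditive_convergent) (simp_all add: rec[simplified], simp add: V_def)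
  then obtain \<kappa> where \<kappa>: "(\<lambda>n. V n / golden_ratio ^ n) \<longlonglongrightarrow> \<kappa>" by (auto simp: convergent_def)
  have "golden_ratio ^ n \<le> V n \<and> golden_ratio ^ (n + 1) \<le> V (n + 1)" for n
  proof (induction n)
    case 0
    have "sqrt 5 \<le> sqrt (3\<^sup>2)" by (rule real_sqrt_le_mono) simp
    then have "golden_ratio \<le> 2" by (simp add: golden_ratio_def)
    then show ?case by (simp add: V_def branch_size_Suc)
  next
    case (Suc n)
    then show ?case using golden_ratio_power[of n] rec[of n] by simp
  qed
  then have "1 \<le> V n / golden_ratio ^ n" for n
    using golden_ratio_gt_1 by (simp add: le_divide_eq)
  then have "1 \<le> \<kappa>" by (intro LIMSEQ_le_const[OF \<kappa>]) blast
  moreover have "(\<lambda>n. real (branch_size n 1) / golden_ratio ^ n) \<longlonglongrightarrow> \<kappa>"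
    using tendsto_diff[OF \<kappa> over_golden_power_tendsto_0[of 2]]
    by (simp add: V_def diff_divide_distrib[symmetric])
  ultimately show thesis using that[of \<kappa>] by simp
qed

text \<open>
  On the logarithmic scale, summing over the labels costs no more than the logarithm of the size of
  the alphabet.
\<close>
lemma ln_sum_close:
  fixes f :: "'a \<Rightarrow> real"
  assumes S: "finite S" "S \<noteq> {}"
    and f: "\<And>b. b \<in> S \<Longrightarrow> 0 < f b" "\<And>b. b \<in> S \<Longrightarrow> \<bar>ln (f b) - c\<bar> \<le> \<delta>"
    and card: "card S \<le> k"
  shows "0 < (\<Sum>b\<in>S. f b)" "\<bar>ln (\<Sum>b\<in>S. f b) - c\<bar> \<le> \<delta> + ln (real k)"
proof -
  show pos: "0 < (\<Sum>b\<in>S. f b)" using S f(1) by (intro sum_pos) auto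
  obtain b where b: "b \<in> S" using S by blast
  have k: "1 \<le> real k" using card S by (metis One_nat_def Suc_leI card_gt_0_iff le_trans of_nat_1 of_nat_le_iff)
  have lo: "f b' \<ge> exp (c - \<delta>)" and hi: "f b' \<le> exp (c + \<delta>)" if "b' \<in> S" for b'
    using f(1)[OF that] f(2)[OF that] ln_ge_iff[of "f b'" "c - \<delta>"]
      ln_le_cancel_iff[of "f b'" "exp (c + \<delta>)"] by auto
  have "exp (c - \<delta>) \<le> f b" by (rule lo[OF b])
  also have "f b \<le> (\<Sum>b\<in>S. f b)"
    using S b f(1) by (intro member_le_sum) (auto simp: less_imp_le)
  finally have "c - \<delta> \<le> ln (\<Sum>b\<in>S. f b)" using pos by (simp add: ln_ge_iff)
  moreover have "(\<Sum>b\<in>S. f b) \<le> real k * exp (c + \<delta>)"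
  proof -
    have "(\<Sum>b\<in>S. f b) \<le> real (card S) * exp (c + \<delta>)"
      using sum_bounded_above[of S f, OF hi] by simp
    also have "\<dots> \<le> real k * exp (c + \<delta>)" using card by (intro mult_right_mono) auto
    finally show ?thesis .
  qed
  then have "ln (\<Sum>b\<in>S. f b) \<le> ln (real k) + (c + \<delta>)"
    using pos k by (metis exp_gt_zero less_le_trans ln_exp ln_le_cancel_iff ln_mult_pos
        mult_pos_pos zero_less_one)
  moreover have "0 \<le> ln (real k)" using k by simp
  ultimately show "\<bar>ln (\<Sum>b\<in>S. f b) - c\<bar> \<le> \<delta> + ln (real k)" by linarith
qed

locale primitive_transitions =
  fixes A :: "real ^ 'k ^ 'k"
  assumes A01: "\<forall>i j. A $ i $ j \<in> {0, 1}"
    and primitive: "primitive_matrix A"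
begin

definition succs :: "'k \<Rightarrow> 'k set" where
  "succs a = {b. A $ a $ b = 1}"

lemma sum_transitions: "(\<Sum>b\<in>UNIV. A $ a $ b * f b) = (\<Sum>b\<in>succs a. f b)"
proof (rule sum.mono_neutral_cong_right)
  show "\<forall>b\<in>UNIV - succs a. A $ a $ b * f b = 0"
    using A01 by (auto simp: succs_def)
qed (auto simp: succs_def)

lemma matrix_power_Suc_pos:
  assumes "0 < matrix_power A (Suc n) $ i $ j"
  obtains l where "0 < matrix_power A n $ i $ l" "j \<in> succs l"
proof -
  have "\<exists>l. 0 < matrix_power A n $ i $ l * A $ l $ j"
  proof (rule ccontr)
    assume "\<not> ?thesis"
    then have "(\<Sum>l\<in>UNIV. matrix_power A n $ i $ l * A $ l $ j) \<le> 0"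
      by (intro sum_nonpos) (simp add: not_less)
    then show False using assms by (simp add: matrix_matrix_mult_def)
  qed
  then obtain l where l: "0 < matrix_power A n $ i $ l * A $ l $ j" by blast
  moreover have "A $ l $ j = 0 \<or> A $ l $ j = 1" using A01 by blast
  ultimately show thesis using that[of l] by (auto simp: succs_def)
qed

lemma succs_nonempty: "succs a \<noteq> {}"
proof -
  have pos: "succs i \<noteq> {}" if "0 < matrix_power A (Suc n) $ i $ j" for n i j
    using that
  proof (induction n arbitrary: j)
    case 0
    obtain l where "0 < matrix_power A 0 $ i $ l" "j \<in> succs l"
      by (rule matrix_power_Suc_pos[OF 0])
    then show ?case by (auto simp: mat_def split: if_splits)
  next
    case (Suc n)
    obtain l where "0 < matrix_power A (Suc n) $ i $ l"
      by (rule matrix_power_Suc_pos[OF Suc.prems])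
    then show ?case by (rule Suc.IH)
  qed
  obtain N where N: "N \<ge> 1" "\<forall>i j. 0 < matrix_power A N $ i $ j"
    using primitive by (auto simp: primitive_matrix_def)
  then obtain n where "N = Suc n" by (cases N) auto
  then show ?thesis using N(2) pos[of n a a] by blast
qed

lemma k_ge_1: "real CARD('k) \<ge> 1"
  by (simp add: Suc_leI)

lemma count_Suc:
  "branch_count A (Suc n) 1 a
    = (\<Sum>b\<in>succs a. branch_count A n 1 b) * (\<Sum>b\<in>succs a. branch_count A n 2 b)"
  "branch_count A (Suc n) 2 a = (\<Sum>b\<in>succs a. branch_count A n 1 b)"
  by (simp_all add: branch_count.simps golden_row sum_transitions)

lemma succs_sum_ge:
  assumes "\<And>b. 0 \<le> f b" "b \<in> succs a"
  shows "f b \<le> (\<Sum>b\<in>succs a. f b :: real)"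
  using assms by (intro member_le_sum) auto

lemma succs_sum_le:
  assumes "\<And>b. f b \<le> M" "0 \<le> M"
  shows "(\<Sum>b\<in>succs a. f b :: real) \<le> real CARD('k) * M"
proof -
  have "(\<Sum>b\<in>succs a. f b) \<le> real (card (succs a)) * M"
    using sum_bounded_above[of "succs a" f M] assms by simp
  also have "\<dots> \<le> real CARD('k) * M"
    using assms card_mono[of UNIV "succs a"] by (intro mult_right_mono) auto
  finally show ?thesis .
qed

lemma count_ge_1: "1 \<le> branch_count A n f a"
proof (induction n arbitrary: f a)
  case (Suc n)
  have "1 \<le> (\<Sum>b\<in>succs a. branch_count A n g b)" for g
  proof -
    obtain b where b: "b \<in> succs a" using succs_nonempty[of a] by blast
    have "0 \<le> branch_count A n g b'" for b' using Suc[of g b'] by simp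
    from succs_sum_ge[of "branch_count A n g", OF this b] Suc[of g b] show ?thesis by simp
  qed
  then show ?case by (simp add: branch_count.simps sum_transitions prod_ge_1)
qed simp

lemma count_nonneg: "0 \<le> branch_count A n f a"
  using count_ge_1[of n f a] by simp

lemma count_pos: "0 < branch_count A n f a"
  using count_ge_1[of n f a] by simp

definition max_count :: "nat \<Rightarrow> real" where
  "max_count n = Max (range (branch_count A n 1))"

lemma count_le_max: "branch_count A n 1 a \<le> max_count n"
  by (simp add: max_count_def)

lemma max_count_attained: "\<exists>a. max_count n = branch_count A n 1 a"
proof -
  have "max_count n \<in> range (branch_count A n 1)"
    unfolding max_count_def by (rule Max_in) auto
  then show ?thesis by blast
qed

lemma max_count_ge_1: "1 \<le> max_count n"
  using count_ge_1 count_le_max order_trans by blast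

lemma count2_le: "branch_count A (Suc n) 2 a \<le> real CARD('k) * max_count n"
  unfolding count_Suc using max_count_ge_1[of n]
  by (intro succs_sum_le count_le_max) simp

lemma max_count_recurrence: "max_count (n + 2) \<le> real CARD('k) ^ 3 * (max_count (n + 1) * max_count n)"
proof -
  obtain a where a: "max_count (n + 2) = branch_count A (Suc (Suc n)) 1 a"
    using max_count_attained[of "n + 2"] by auto
  also have "\<dots> \<le> (real CARD('k) * max_count (Suc n)) * (real CARD('k) * (real CARD('k) * max_count n))"
    unfolding count_Suc(1)[of "Suc n"] using max_count_ge_1[of "Suc n"] max_count_ge_1[of n]
    by (intro mult_mono succs_sum_le count_le_max count2_le sum_nonneg count_nonneg) auto
  finally show ?thesis by (simp add: power3_eq_cube ac_simps)
qed

lemma max_count_asymptotic: "convergent (\<lambda>n. ln (max_count n) / golden_ratio ^ n)"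
proof -
  define Q where "Q n = ln (max_count n) + 3 * ln (real CARD('k))" for n
  have "convergent (\<lambda>n. Q n / golden_ratio ^ n)"
  proof (rule fibonacci_subadditive_convergent)
    show "0 \<le> Q n" for n using max_count_ge_1[of n] k_ge_1 by (simp add: Q_def)
    show "Q (n + 2) \<le> Q (n + 1) + Q n" for n
    proof -
      have pos: "0 < max_count i" for i using max_count_ge_1[of i] by simp
      have "ln (max_count (n + 2)) \<le> ln (real CARD('k) ^ 3 * (max_count (n + 1) * max_count n))"
        using max_count_recurrence[of n] pos[of "n + 2"] by (simp add: ln_mono)
      also have "\<dots> = 3 * ln (real CARD('k)) + (ln (max_count (n + 1)) + ln (max_count n))"
        using pos[of n] pos[of "n + 1"] k_ge_1 by (simp add: ln_mult_pos ln_realpow)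
      finally show ?thesis by (simp add: Q_def)
    qed
  qed
  then obtain H where "(\<lambda>n. Q n / golden_ratio ^ n) \<longlonglongrightarrow> H" by (auto simp: convergent_def)
  from tendsto_diff[OF this over_golden_power_tendsto_0[of "3 * ln (real CARD('k))"]]
  show ?thesis by (auto simp: convergent_def Q_def diff_divide_distrib[symmetric])
qed

text \<open>
  The children of the root of the larger branch may both be labelled \<open>b\<close>. The count below the child
  of type \<open>f\<^sub>2\<close> is bounded from below by comparing it with the count below the child of type
  \<open>f\<^sub>1\<close>, which is larger only by the factor that its own second child contributes.
\<close>
lemma count_step:
  assumes "b \<in> succs a"
  shows "(branch_count A (Suc (Suc n)) 1 b)\<^sup>2
    \<le> branch_count A (Suc (Suc (Suc n))) 1 a * ((real CARD('k))\<^sup>2 * max_count n)"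
proof -
  let ?n = "Suc (Suc n)"
  have "branch_count A ?n 1 b
      = branch_count A ?n 2 b * (\<Sum>c\<in>succs b. branch_count A (Suc n) 2 c)"
    by (simp only: count_Suc)
  also have "\<dots> \<le> branch_count A ?n 2 b * (real CARD('k) * (real CARD('k) * max_count n))"
    using max_count_ge_1[of n]
    by (intro mult_left_mono succs_sum_le count2_le count_nonneg) auto
  finally have 1: "branch_count A ?n 1 b \<le> branch_count A ?n 2 b * ((real CARD('k))\<^sup>2 * max_count n)"
    by (simp add: power2_eq_square ac_simps)
  have 2: "branch_count A ?n 1 b * branch_count A ?n 2 b \<le> branch_count A (Suc ?n) 1 a"
    unfolding count_Suc(1)[of ?n]
    by (intro mult_mono succs_sum_ge assms count_nonneg sum_nonneg)
  have "(branch_count A ?n 1 b)\<^sup>2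
      \<le> branch_count A ?n 1 b * (branch_count A ?n 2 b * ((real CARD('k))\<^sup>2 * max_count n))"
    unfolding power2_eq_square by (intro mult_left_mono 1[unfolded power2_eq_square] count_nonneg)
  also have "\<dots> = (branch_count A ?n 1 b * branch_count A ?n 2 b) * ((real CARD('k))\<^sup>2 * max_count n)"
    by simp
  also have "\<dots> \<le> branch_count A (Suc ?n) 1 a * ((real CARD('k))\<^sup>2 * max_count n)"
    using max_count_ge_1[of n] by (intro mult_right_mono 2) auto
  finally show ?thesis .
qed

text \<open>
  The label \<open>b t\<close> may depend on the depth, because the label with the largest count may change from
  depth to depth.
\<close>
lemma growth_step:
  assumes H: "(\<lambda>n. ln (max_count n) / golden_ratio ^ n) \<longlonglongrightarrow> H"
    and b: "(\<lambda>t. ln (branch_count A (t + m) 1 (b t)) / golden_ratio ^ (t + m)) \<longlonglongrightarrow> H"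
    and ab: "\<And>t. b t \<in> succs (a t)"
  shows "(\<lambda>t. ln (branch_count A (t + Suc m) 1 (a t)) / golden_ratio ^ (t + Suc m)) \<longlonglongrightarrow> H"
  \<comment> \<open>the shift by 2 makes room for the index \<open>n - 2\<close> of the maximum in \<open>count_step\<close>\<close>
proof (rule LIMSEQ_offset[where k = 2], rule tendsto_sandwich)
  note gr = golden_ratio_gt_1
  let ?X = "\<lambda>t. ln (branch_count A (t + 2 + Suc m) 1 (a (t + 2))) / golden_ratio ^ (t + 2 + Suc m)"
  let ?Y = "\<lambda>t. ln (branch_count A (t + 2 + m) 1 (b (t + 2))) / golden_ratio ^ (t + 2 + m)"
  let ?Z = "\<lambda>t. ln (max_count (t + m)) / golden_ratio ^ (t + m)"
  let ?L = "\<lambda>t. 2 / golden_ratio * ?Y t - 1 / golden_ratio ^ 3 * ?Z t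
    - 2 * ln (real CARD('k)) / golden_ratio ^ (t + (m + 3))"
  have "?L t \<le> ?X t" for t
  proof -
    define x where "x = branch_count A (t + 2 + Suc m) 1 (a (t + 2))"
    define y where "y = branch_count A (t + 2 + m) 1 (b (t + 2))"
    define z where "z = max_count (t + m)"
    have pos: "0 < x" "0 < y" "0 < z"
      using max_count_ge_1[of "t + m"] by (auto simp: x_def y_def z_def intro: count_pos)
    have "y\<^sup>2 \<le> x * ((real CARD('k))\<^sup>2 * z)"
      using count_step[OF ab[of "t + 2"], of "t + m"] unfolding x_def y_def z_def
      by simp
    then have "ln (y\<^sup>2) \<le> ln (x * ((real CARD('k))\<^sup>2 * z))" using pos by (simp add: ln_mono)
    then have "2 * ln y \<le> ln x + (2 * ln (real CARD('k)) + ln z)"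
      using pos k_ge_1 by (simp add: ln_mult_pos ln_realpow)
    then have "(2 * ln y - ln z - 2 * ln (real CARD('k))) / golden_ratio ^ (t + (m + 3))
        \<le> ln x / golden_ratio ^ (t + (m + 3))"
      using gr by (intro divide_right_mono) auto
    moreover have "2 / golden_ratio * (ln y / golden_ratio ^ (t + 2 + m))
        = 2 * ln y / golden_ratio ^ (t + (m + 3))"
      using gr by (simp add: power_add eval_nat_numeral)
    moreover have "1 / golden_ratio ^ 3 * (ln z / golden_ratio ^ (t + m))
        = ln z / golden_ratio ^ (t + (m + 3))"
      using gr by (simp add: power_add eval_nat_numeral)
    moreover have "?X t = ln x / golden_ratio ^ (t + (m + 3))"
    proof -
      have "t + 2 + Suc m = t + (m + 3)" by simp
      then show ?thesis by (simp only: x_def)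
    qed
    ultimately show ?thesis
      by (simp only: y_def[symmetric] z_def[symmetric] diff_divide_distrib)
  qed
  then show "eventually (\<lambda>t. ?L t \<le> ?X t) sequentially" by simp
  have "?X t \<le> ln (max_count (t + (m + 3))) / golden_ratio ^ (t + (m + 3))" for t
  proof -
    have "t + 2 + Suc m = t + (m + 3)" by simp
    then show ?thesis
      using gr count_le_max[of "t + (m + 3)" "a (t + 2)"] count_pos[of "t + (m + 3)" 1 "a (t + 2)"]
      by (simp only:) (intro divide_right_mono ln_mono, auto)
  qed
  then show "eventually (\<lambda>t. ?X t \<le> ln (max_count (t + (m + 3))) / golden_ratio ^ (t + (m + 3)))
      sequentially" by simp
  show "(\<lambda>t. ln (max_count (t + (m + 3))) / golden_ratio ^ (t + (m + 3))) \<longlonglongrightarrow> H"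
    by (rule LIMSEQ_ignore_initial_segment[OF H])
  have "?L \<longlonglongrightarrow> 2 / golden_ratio * H - 1 / golden_ratio ^ 3 * H - 0"
    by (intro tendsto_diff tendsto_mult tendsto_const
        LIMSEQ_ignore_initial_segment[OF b, of 2] LIMSEQ_ignore_initial_segment[OF H]
        LIMSEQ_ignore_initial_segment[OF over_golden_power_tendsto_0])
  also have "2 / golden_ratio * H - 1 / golden_ratio ^ 3 * H - 0 = H"
  proof -
    have "golden_ratio ^ 3 = 2 * golden_ratio\<^sup>2 - 1"
      using golden_ratio_power[of 1] golden_ratio_square by (simp add: eval_nat_numeral)
    then have "2 / golden_ratio - 1 / golden_ratio ^ 3 = 1"
      using gr by (simp add: field_simps power2_eq_square eval_nat_numeral)
    then show ?thesis by (metis diff_zero left_diff_distrib mult_1)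
  qed
  finally show "?L \<longlonglongrightarrow> H" .
qed

lemma growth_along_paths:
  assumes H: "(\<lambda>n. ln (max_count n) / golden_ratio ^ n) \<longlonglongrightarrow> H"
    and b: "(\<lambda>t. ln (branch_count A (t + m) 1 (b t)) / golden_ratio ^ (t + m)) \<longlonglongrightarrow> H"
    and path: "\<And>t. 0 < matrix_power A n $ a t $ b t"
  shows "(\<lambda>t. ln (branch_count A (t + (m + n)) 1 (a t)) / golden_ratio ^ (t + (m + n))) \<longlonglongrightarrow> H"
  using b path
proof (induction n arbitrary: m b)
  case 0
  have "a t = b t" for t using 0(2)[of t] by (auto simp: mat_def split: if_splits)
  then show ?case using 0(1) by simp
next
  case (Suc n)
  have "\<exists>l. 0 < matrix_power A n $ a t $ l \<and> b t \<in> succs l" for t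
    by (rule matrix_power_Suc_pos[OF Suc.prems(2)[of t]]) blast
  then obtain l where l: "\<And>t. 0 < matrix_power A n $ a t $ l t" "\<And>t. b t \<in> succs (l t)"
    by metis
  show ?case
    using Suc.IH[OF growth_step[OF H Suc.prems(1) l(2)] l(1)] by simp
qed

lemma count_asymptotic:
  assumes H: "(\<lambda>n. ln (max_count n) / golden_ratio ^ n) \<longlonglongrightarrow> H"
  shows "(\<lambda>n. ln (branch_count A n 1 a) / golden_ratio ^ n) \<longlonglongrightarrow> H"
proof -
  obtain N where N: "\<And>i j. 0 < matrix_power A N $ i $ j"
    using primitive by (auto simp: primitive_matrix_def)
  obtain b where "\<And>n. max_count n = branch_count A n 1 (b n)"
    using max_count_attained by metis
  then have "(\<lambda>t. ln (branch_count A (t + 0) 1 (b t)) / golden_ratio ^ (t + 0)) \<longlonglongrightarrow> H"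
    using H by simp
  from growth_along_paths[OF H this, of N "\<lambda>_. a"] N
  have "(\<lambda>t. ln (branch_count A (t + N) 1 a) / golden_ratio ^ (t + N)) \<longlonglongrightarrow> H" by simp
  then show ?thesis by (rule LIMSEQ_offset)
qed

text \<open>
  Both types have the same rate, since a branch of type \<open>f\<^sub>2\<close> and depth \<open>n + 1\<close> is a branch of type
  \<open>f\<^sub>1\<close> and depth \<open>n\<close> with one node on top.
\<close>
lemma branch_entropy:
  obtains h where "\<And>f a. (\<lambda>n. ln (branch_count A n f a) / real (branch_size n f)) \<longlonglongrightarrow> h"
proof -
  note gr = golden_ratio_gt_1
  obtain H where H: "(\<lambda>n. ln (max_count n) / golden_ratio ^ n) \<longlonglongrightarrow> H"
    using max_count_asymptotic by (auto simp: convergent_def)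
  obtain \<kappa> where \<kappa>: "\<kappa> > 0" "(\<lambda>n. real (branch_size n 1) / golden_ratio ^ n) \<longlonglongrightarrow> \<kappa>"
    by (rule branch_size_asymptotic)
  have 1: "(\<lambda>n. ln (branch_count A n 1 a) / real (branch_size n 1)) \<longlonglongrightarrow> H / \<kappa>" for a
    using tendsto_divide[OF count_asymptotic[OF H, of a] \<kappa>(2)] \<kappa>(1) gr by simp
  have 2: "(\<lambda>n. ln (branch_count A n 2 a) / real (branch_size n 2)) \<longlonglongrightarrow> H / \<kappa>" for a
  proof (rule LIMSEQ_offset[where k = 1])
    obtain b where b: "b \<in> succs a" using succs_nonempty[of a] by blast
    have lo: "ln (branch_count A n 1 b) / golden_ratio ^ n
        \<le> ln (branch_count A (Suc n) 2 a) / golden_ratio ^ n" for n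
    proof (intro divide_right_mono ln_mono)
      show "branch_count A n 1 b \<le> branch_count A (Suc n) 2 a"
        unfolding count_Suc by (intro succs_sum_ge b count_nonneg)
    qed (use gr count_pos in auto)
    have hi: "ln (branch_count A (Suc n) 2 a) / golden_ratio ^ n
        \<le> ln (real CARD('k)) / golden_ratio ^ n + ln (max_count n) / golden_ratio ^ n" for n
    proof -
      have "ln (branch_count A (Suc n) 2 a) \<le> ln (real CARD('k) * max_count n)"
        by (intro ln_mono count2_le count_pos)
      also have "\<dots> = ln (real CARD('k)) + ln (max_count n)"
        using k_ge_1 max_count_ge_1[of n] by (intro ln_mult_pos) auto
      finally show ?thesis
        using gr by (simp add: add_divide_distrib[symmetric] divide_right_mono)
    qed
    have "(\<lambda>n. ln (real CARD('k)) / golden_ratio ^ n + ln (max_count n) / golden_ratio ^ n) \<longlonglongrightarrow> 0 + H"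
      by (intro tendsto_add over_golden_power_tendsto_0 H)
    then have count: "(\<lambda>n. ln (branch_count A (Suc n) 2 a) / golden_ratio ^ n) \<longlonglongrightarrow> H"
      using tendsto_sandwich[OF always_eventually[OF allI[OF lo]]
          always_eventually[OF allI[OF hi]] count_asymptotic[OF H]] by simp
    have "(\<lambda>n. 1 / golden_ratio ^ n + real (branch_size n 1) / golden_ratio ^ n) \<longlonglongrightarrow> 0 + \<kappa>"
      by (intro tendsto_add over_golden_power_tendsto_0 \<kappa>(2))
    then have size: "(\<lambda>n. real (branch_size (Suc n) 2) / golden_ratio ^ n) \<longlonglongrightarrow> \<kappa>"
      by (simp add: branch_size_Suc add_divide_distrib)
    show "(\<lambda>n. ln (branch_count A (n + 1) 2 a) / real (branch_size (n + 1) 2)) \<longlonglongrightarrow> H / \<kappa>"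
      using tendsto_divide[OF count size] \<kappa>(1) gr
      by simp
  qed
  have "(\<lambda>n. ln (branch_count A n f a) / real (branch_size n f)) \<longlonglongrightarrow> H / \<kappa>" for f a
    using 1 2 exhaust_2[of f] by auto
  then show thesis by (rule that)
qed

lemma branch_entropy_uniform:
  assumes h: "\<And>f a. (\<lambda>n. ln (branch_count A n f a) / real (branch_size n f)) \<longlonglongrightarrow> h"
    and \<epsilon>: "\<epsilon> > 0"
  shows "eventually (\<lambda>n. \<forall>f a. \<bar>ln (branch_count A n f a) - h * real (branch_size n f)\<bar>
    \<le> \<epsilon> * real (branch_size n f)) sequentially"
proof (intro eventually_all_finite)
  fix f a
  have "eventually (\<lambda>n. dist (ln (branch_count A n f a) / real (branch_size n f)) h < \<epsilon>) sequentially"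
    using tendstoD[OF h \<epsilon>] .
  then show "eventually (\<lambda>n. \<bar>ln (branch_count A n f a) - h * real (branch_size n f)\<bar>
    \<le> \<epsilon> * real (branch_size n f)) sequentially"
  proof (eventually_elim)
    fix n assume *: "dist (ln (branch_count A n f a) / real (branch_size n f)) h < \<epsilon>"
    have pos: "0 < real (branch_size n f)" using branch_size_ge[of n f] by simp
    have "ln (branch_count A n f a) - h * real (branch_size n f)
        = (ln (branch_count A n f a) / real (branch_size n f) - h) * real (branch_size n f)"
      using pos by (simp add: left_diff_distrib)
    then have "\<bar>ln (branch_count A n f a) - h * real (branch_size n f)\<bar>
        = dist (ln (branch_count A n f a) / real (branch_size n f)) h * real (branch_size n f)"
      using pos by (simp add: abs_mult dist_real_def)
    also have "\<dots> \<le> \<epsilon> * real (branch_size n f)"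
      using * pos by (intro mult_right_mono) auto
    finally show "\<bar>ln (branch_count A n f a) - h * real (branch_size n f)\<bar>
      \<le> \<epsilon> * real (branch_size n f)" .
  qed
qed

section \<open>Entropy of the tree-shift\<close>

lemma card_patterns:
  assumes "F \<subseteq> golden_tree" "[] \<in> F" "\<And>w f. w @ [f] \<in> F \<Longrightarrow> w \<in> F" "finite F"
  shows "real (card (patterns F (tree_shift A))) = (\<Sum>a\<in>UNIV. real (rooted A F [] a))"
proof -
  have "\<exists>b. A $ a $ b = 1" for a using succs_nonempty[of a] by (auto simp: succs_def)
  from patterns_eq_labelings[OF this assms(1-3)] show ?thesis
    by (simp add: card_labelings[OF assms(4), of A "[]"])
qed

lemma card_patterns_Delta:
  "real (card (patterns (Delta n) (tree_shift A))) = (\<Sum>a\<in>UNIV. branch_count A n 1 a)"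
proof -
  have "real (card (patterns (Delta n) (tree_shift A))) = (\<Sum>a\<in>UNIV. real (rooted A (Delta n) [] a))"
  proof (rule card_patterns)
    show "w \<in> Delta n" if "w @ [f] \<in> Delta n" for w f
      using that by (auto simp: Delta_eq_subtree subtree_def golden_tree_snoc)
    show "finite (Delta n)" by (simp add: Delta_eq_subtree)
  qed (auto simp: Delta_eq_subtree subtree_def)
  also have "\<dots> = (\<Sum>a\<in>UNIV. branch_count A n 1 a)"
    using rooted_subtree[OF A01, of "[]" n] by (simp add: Delta_eq_subtree node_type_def)
  finally show ?thesis .
qed

lemma entropy_eq:
  assumes h: "\<And>f a. (\<lambda>n. ln (branch_count A n f a) / real (branch_size n f)) \<longlonglongrightarrow> h"
  shows "entropy (tree_shift A) = h"
proof -
  let ?N = "\<lambda>n. \<Sum>a\<in>UNIV. branch_count A n 1 a"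
  have "(\<lambda>n. ln (?N n) / real (branch_size n 1)) \<longlonglongrightarrow> h"
  proof (rule LIMSEQ_I)
    fix \<epsilon> :: real assume \<epsilon>: "\<epsilon> > 0"
    have "(\<lambda>n. ln (real CARD('k)) / real (n + 1)) \<longlonglongrightarrow> 0"
      by real_asymp
    then have "eventually (\<lambda>n. ln (real CARD('k)) / real (n + 1) < \<epsilon> / 2) sequentially"
      using \<epsilon> by (intro order_tendstoD(2)) auto
    moreover have "eventually (\<lambda>n. \<forall>f a. \<bar>ln (branch_count A n f a) - h * real (branch_size n f)\<bar>
        \<le> \<epsilon> / 2 * real (branch_size n f)) sequentially"
      using \<epsilon> by (intro branch_entropy_uniform h) auto
    ultimately have "eventually (\<lambda>n. norm (ln (?N n) / real (branch_size n 1) - h) < \<epsilon>) sequentially"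
    proof eventually_elim
      fix n
      assume n: "ln (real CARD('k)) / real (n + 1) < \<epsilon> / 2"
        and close: "\<forall>f a. \<bar>ln (branch_count A n f a) - h * real (branch_size n f)\<bar>
          \<le> \<epsilon> / 2 * real (branch_size n f)"
      define s where "s = real (branch_size n 1)"
      have s: "real (n + 1) \<le> s" "0 < s"
        using branch_size_ge[of n 1] by (simp_all add: s_def)
      have "\<bar>ln (?N n) - h * s\<bar> \<le> \<epsilon> / 2 * s + ln (real CARD('k))"
        unfolding s_def using close by (intro ln_sum_close(2) count_pos) auto
      moreover have "ln (real CARD('k)) < \<epsilon> / 2 * s"
      proof -
        have "ln (real CARD('k)) < \<epsilon> / 2 * real (n + 1)"
          using n by (simp add: divide_less_eq)
        also have "\<dots> \<le> \<epsilon> / 2 * s" using s \<epsilon> by (intro mult_left_mono) auto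
        finally show ?thesis .
      qed
      ultimately have "\<bar>ln (?N n) - h * s\<bar> < \<epsilon> * s" by simp
      moreover have "\<bar>ln (?N n) / s - h\<bar> = \<bar>ln (?N n) - h * s\<bar> / s"
      proof -
        have "ln (?N n) / s - h = (ln (?N n) - h * s) / s" using s by (simp add: diff_divide_distrib)
        then show ?thesis using s by simp
      qed
      ultimately show "norm (ln (?N n) / real (branch_size n 1) - h) < \<epsilon>"
        using s by (simp add: s_def[symmetric] divide_less_eq)
    qed
    then show "\<exists>no. \<forall>n\<ge>no. norm (ln (?N n) / real (branch_size n 1) - h) < \<epsilon>"
      by (simp add: eventually_sequentially)
  qed
  moreover have "card (Delta n) = branch_size n 1" for n
    by (simp add: Delta_eq_subtree card_subtree node_type_def)
  ultimately have "(\<lambda>n. ln (real (card (patterns (Delta n) (tree_shift A)))) / real (card (Delta n))) \<longlonglongrightarrow> h"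
    by (simp add: card_patterns_Delta)
  then show ?thesis unfolding entropy_def by (rule limI)
qed

end

section \<open>Strips along a ray\<close>

lemma rays_cases:
  assumes "p \<in> rays"
  obtains s where "p 0 = []" "\<And>j. p (Suc j) = p j @ [s j]" "\<And>j. p j \<in> golden_tree"
    "\<And>j. length (p j) = j"
proof -
  obtain s where s: "\<And>n. n \<ge> 1 \<Longrightarrow> p n = map s [1..<Suc n]" "\<And>n. n \<ge> 1 \<Longrightarrow> p n \<in> words n"
    and p0: "p 0 = []"
    using assms unfolding rays_def by blast
  have p: "p n = map s [1..<Suc n]" for n
    using s(1)[of n] p0 by (cases n) auto
  show thesis
  proof (rule that[of "\<lambda>j. s (Suc j)"])
    show "p (Suc j) = p j @ [s (Suc j)]" for j by (simp add: p)
    show "p j \<in> golden_tree" for j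
    proof (cases "j = 0")
      case True
      then show ?thesis by (simp add: p0)
    next
      case False
      then show ?thesis using s(2)[of j] by (auto simp: golden_tree_def)
    qed
    show "length (p j) = j" for j by (simp add: p)
  qed (rule p0)
qed

definition other :: "2 \<Rightarrow> 2" where
  "other f = (if f = 1 then 2 else 1)"

lemma neq_iff_other: "g \<noteq> f \<longleftrightarrow> g = other f"
  using exhaust_2[of f] exhaust_2[of g] by (auto simp: other_def)

locale ray_strip = primitive_transitions A for A :: "real ^ 'k ^ 'k" +
  fixes p :: "nat \<Rightarrow> 2 list" and s :: "nat \<Rightarrow> 2"
  assumes p_0: "p 0 = []"
    and p_Suc: "\<And>j. p (Suc j) = p j @ [s j]"
    and p_tree: "\<And>j. p j \<in> golden_tree"
    and length_p: "\<And>j. length (p j) = j"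
begin

abbreviation side_root :: "nat \<Rightarrow> 2 list" where
  "side_root j \<equiv> p j @ [other (s j)]"

text \<open>
  The side branch has depth \<open>n\<close> in a strip of width \<open>n + 2\<close>, because \<open>strip_part\<close> bounds the depth
  below the ray by the width minus 1 and the first step leads to the root of the branch. The branch
  is empty if its root is not in the tree.
\<close>
lemma strip_part_eq: "strip_part (n + 2) p j = insert (p j) (subtree n (side_root j))"
proof -
  have "v \<in> strip_part (n + 2) p j \<longleftrightarrow> v = p j \<or> v \<in> subtree n (side_root j)" for v
  proof
    assume "v \<in> strip_part (n + 2) p j"
    then obtain w where w: "v = p j @ w" "v \<in> golden_tree" "length v \<le> j + n + 1"
        "w = [] \<or> hd w = other (s j)"
      by (auto simp: strip_part_def p_Suc neq_iff_other)
    then show "v = p j \<or> v \<in> subtree n (side_root j)"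
      by (cases w) (auto simp: subtree_def prefix_def length_p)
  next
    assume "v = p j \<or> v \<in> subtree n (side_root j)"
    then show "v \<in> strip_part (n + 2) p j"
    proof
      assume "v = p j"
      then show ?thesis using p_tree by (auto simp: strip_part_def length_p)
    next
      assume v: "v \<in> subtree n (side_root j)"
      then obtain w where w: "v = p j @ (other (s j) # w)" by (auto simp: subtree_def prefix_def)
      have "other (s j) \<noteq> s j" by (simp add: neq_iff_other)
      then show ?thesis
        using v unfolding strip_part_def subtree_def w
        by (auto simp: p_Suc length_p intro!: exI[of _ "other (s j) # w"])
    qed
  qed
  then show ?thesis by blast
qed

lemma finite_strip_part: "finite (strip_part (n + 2) p j)"
  by (simp only: strip_part_eq) simp

lemma strip_part_tree: "strip_part n p j \<subseteq> golden_tree"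
  by (auto simp: strip_part_def)

lemma strip_part_prefix: "v \<in> strip_part n p j \<Longrightarrow> prefix (p j) v"
  by (auto simp: strip_part_def)

lemma strip_part_off_ray: "v \<in> strip_part n p j \<Longrightarrow> \<not> prefix (p (Suc j)) v"
  by (auto simp: strip_part_def p_Suc prefix_def)

lemma p_prefix: "i \<le> j \<Longrightarrow> prefix (p i) (p j)"
proof (induction j rule: dec_induct)
  case (step j)
  then show ?case by (simp add: p_Suc prefix_snoc)
qed simp

text \<open>
  Unlike \<open>strip\<close>, a segment may start at any position, as the induction that removes its first
  position requires. Its width \<open>n + 2\<close> gives side branches of depth \<open>n\<close>.
\<close>
definition segment :: "nat \<Rightarrow> nat \<Rightarrow> nat \<Rightarrow> 2 list set" where
  "segment n i m = (\<Union>j\<in>{i..<m}. strip_part (n + 2) p j)"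

lemma segment_Suc: "i < m \<Longrightarrow> segment n i m = strip_part (n + 2) p i \<union> segment n (Suc i) m"
proof -
  assume "i < m"
  then have "{i..<m} = insert i {Suc i..<m}" by auto
  then show ?thesis by (simp add: segment_def)
qed

lemma segment_empty: "segment n i i = {}"
  by (simp add: segment_def)

lemma finite_segment: "finite (segment n i m)"
  unfolding segment_def using finite_strip_part by blast

lemma segment_prefix: "v \<in> segment n i m \<Longrightarrow> prefix (p i) v"
  using p_prefix strip_part_prefix unfolding segment_def
  by (meson UN_E atLeastLessThan_iff prefix_order.trans)

lemma p_in_strip_part: "p i \<in> strip_part (n + 2) p i"
  by (simp only: strip_part_eq) simp

lemma p_in_segment: "i < m \<Longrightarrow> p i \<in> segment n i m"
  using p_in_strip_part[of i n] by (simp add: segment_Suc)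

lemma card_segment:
  assumes "i < m"
  shows "card (segment n i m) = card (strip_part (n + 2) p i) + card (segment n (Suc i) m)"
  unfolding segment_Suc[OF assms]
  using strip_part_off_ray[of _ "n + 2" i] segment_prefix[of _ n "Suc i" m]
  by (intro card_Un_disjoint finite_strip_part finite_segment) blast

lemma card_strip_part:
  "card (strip_part (n + 2) p i) =
    (if side_root i \<in> golden_tree then 1 + branch_size n (other (s i)) else 1)"
proof -
  have "p i \<notin> subtree n (side_root i)" by (auto simp: subtree_def prefix_def)
  then have "card (strip_part (n + 2) p i) = 1 + card (subtree n (side_root i))"
    by (simp add: strip_part_eq[simplified])
  then show ?thesis using card_subtree[of "side_root i" n] by (simp add: subtree_empty)
qed

lemma side_root_in_tree: "side_root i \<in> golden_tree \<longleftrightarrow> node_type (p i) = 1"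
proof -
  have "golden_matrix $ node_type (p i) $ s i = 1"
    using p_tree[of "Suc i"] by (simp add: p_Suc golden_tree_snoc)
  then show ?thesis
    using p_tree[of i] exhaust_2[of "s i"] exhaust_2[of "node_type (p i)"]
    by (auto simp: golden_tree_snoc golden_matrix_eq_1 other_def)
qed

text \<open>
  A position without side branch is followed by one that has a side branch of at least \<open>n + 1\<close>
  nodes. Only a missing side branch at the first position is not paid for by its predecessor, which
  gives the last summand.
\<close>
lemma segment_large:
  "(n + 1) * d \<le> 2 * card (segment n i (i + d)) + (if node_type (p i) = 2 then n + 1 else 0)"
proof (induction d arbitrary: i)
  case (Suc d)
  have card: "card (segment n i (i + Suc d))
      = card (strip_part (n + 2) p i) + card (segment n (Suc i) (Suc i + d))"
    using card_segment[of i "i + Suc d" n] by simp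
  show ?case
  proof (cases "node_type (p i) = 2")
    case True
    have "s i = 1"
      using p_tree[of "Suc i"] True exhaust_2[of "s i"]
      by (auto simp: p_Suc golden_tree_snoc golden_matrix_eq_1)
    then have "node_type (p (Suc i)) \<noteq> 2" by (simp add: p_Suc)
    then show ?thesis using Suc[of "Suc i"] True card by simp
  next
    case False
    then have "n + 1 \<le> card (strip_part (n + 2) p i)"
      using side_root_in_tree[of i] exhaust_2[of "node_type (p i)"]
        branch_size_ge[of n "other (s i)"] card_strip_part[of n i] by simp
    moreover have "(n + 1) * d \<le> 2 * card (segment n (Suc i) (Suc i + d)) + (n + 1)"
      using Suc[of "Suc i"] by (simp split: if_splits)
    ultimately show ?thesis using False card by simp
  qed
qed simp

lemma rooted_strip_part:
  "real (rooted A (strip_part (n + 2) p i) (p i) a) =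
    (if side_root i \<in> golden_tree then \<Sum>b\<in>succs a. branch_count A n (other (s i)) b else 1)"
proof (cases "side_root i \<in> golden_tree")
  case True
  have "real (rooted A (subtree n (side_root i)) (side_root i) b) = branch_count A n (other (s i)) b" for b
    using rooted_subtree[OF A01 True] by simp
  from rooted_insert[OF A01 True this] show ?thesis
    using True by (simp only: strip_part_eq sum_transitions if_True)
next
  case False
  then show ?thesis
    by (simp only: strip_part_eq subtree_empty[OF False] rooted_singleton if_False of_nat_1)
qed

text \<open>
  The side branch contributes the error \<open>\<epsilon>\<close> per node. The ray node adds 1 to the number of nodes,
  which costs \<open>\<bar>h\<bar>\<close>, and the choice of the label at the root of the branch costs the logarithm of
  the size of the alphabet.
\<close>
lemma rooted_strip_part_close:
  assumes \<epsilon>: "\<epsilon> > 0"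
    and close: "\<And>f a. \<bar>ln (branch_count A n f a) - h * real (branch_size n f)\<bar>
      \<le> \<epsilon> * real (branch_size n f)"
  shows "0 < real (rooted A (strip_part (n + 2) p i) (p i) a)"
    and "\<bar>ln (real (rooted A (strip_part (n + 2) p i) (p i) a))
        - h * real (card (strip_part (n + 2) p i))\<bar>
      \<le> \<epsilon> * real (card (strip_part (n + 2) p i)) + (ln (real CARD('k)) + \<bar>h\<bar>)"
proof -
  define c where "c = real (card (strip_part (n + 2) p i))"
  define r where "r = real (rooted A (strip_part (n + 2) p i) (p i) a)"
  have "0 < r \<and> \<bar>ln r - h * c\<bar> \<le> \<epsilon> * c + (ln (real CARD('k)) + \<bar>h\<bar>)"
  proof (cases "side_root i \<in> golden_tree")
    case True
    let ?f = "other (s i)"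
    have r: "r = (\<Sum>b\<in>succs a. branch_count A n ?f b)"
      using True by (simp only: r_def rooted_strip_part if_True)
    have c: "c = 1 + real (branch_size n ?f)"
      using True card_strip_part[of n i] by (simp add: c_def)
    have "0 < r" unfolding r using count_pos succs_nonempty by (intro sum_pos) auto
    moreover have "\<bar>ln r - h * real (branch_size n ?f)\<bar>
        \<le> \<epsilon> * real (branch_size n ?f) + ln (real CARD('k))"
      unfolding r using succs_nonempty
      by (intro ln_sum_close(2) count_pos close) (auto intro: card_mono)
    ultimately show ?thesis
      using \<epsilon> unfolding c by (simp add: distrib_left)
  next
    case False
    have "r = 1" using False by (simp only: r_def rooted_strip_part if_False)
    moreover have "c = 1" using False card_strip_part[of n i] by (simp add: c_def)
    moreover have "0 \<le> ln (real CARD('k))" using k_ge_1 by simp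
    ultimately show ?thesis using \<epsilon> by simp
  qed
  then show "0 < real (rooted A (strip_part (n + 2) p i) (p i) a)"
    and "\<bar>ln (real (rooted A (strip_part (n + 2) p i) (p i) a))
        - h * real (card (strip_part (n + 2) p i))\<bar>
      \<le> \<epsilon> * real (card (strip_part (n + 2) p i)) + (ln (real CARD('k)) + \<bar>h\<bar>)"
    unfolding c_def r_def by blast+
qed

text \<open>
  Every position on the ray costs the constant of \<open>rooted_strip_part_close\<close> and once more the
  logarithm of the size of the alphabet, for the label of the next position.
\<close>
lemma rooted_segment_close:
  assumes \<epsilon>: "\<epsilon> > 0"
    and close: "\<And>f a. \<bar>ln (branch_count A n f a) - h * real (branch_size n f)\<bar>
      \<le> \<epsilon> * real (branch_size n f)"
  shows "0 < real (rooted A (segment n i (i + Suc d)) (p i) a) \<and>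
    \<bar>ln (real (rooted A (segment n i (i + Suc d)) (p i) a)) - h * real (card (segment n i (i + Suc d)))\<bar>
      \<le> \<epsilon> * real (card (segment n i (i + Suc d))) + real (Suc d) * (2 * ln (real CARD('k)) + \<bar>h\<bar>)"
proof (induction d arbitrary: i a)
  case 0
  have seg: "segment n i (i + Suc 0) = strip_part (n + 2) p i"
    using segment_Suc[of i "Suc i" n] by (simp add: segment_empty)
  have "ln (real CARD('k)) + \<bar>h\<bar> \<le> real (Suc 0) * (2 * ln (real CARD('k)) + \<bar>h\<bar>)"
    using k_ge_1 by simp
  then show ?case
    unfolding seg using rooted_strip_part_close[OF \<epsilon> close, of i a] by linarith
next
  case (Suc d)
  let ?B = "strip_part (n + 2) p i" and ?C = "segment n (Suc i) (Suc i + Suc d)"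
  let ?K = "2 * ln (real CARD('k)) + \<bar>h\<bar>"
  let ?S = "\<Sum>b\<in>succs a. real (rooted A ?C (p (Suc i)) b)"
  have i: "i + Suc (Suc d) = Suc i + Suc d" by simp
  have seg: "segment n i (i + Suc (Suc d)) = ?B \<union> ?C"
    unfolding i by (rule segment_Suc) simp
  have card: "card (segment n i (i + Suc (Suc d))) = card ?B + card ?C"
    unfolding i by (rule card_segment) simp
  have "real (rooted A (?B \<union> ?C) (p i) a) = real (rooted A ?B (p i) a) * ?S"
    unfolding p_Suc sum_transitions[symmetric]
  proof (rule rooted_glue)
    show "p i \<in> ?B" by (rule p_in_strip_part)
    show "p i @ [s i] \<in> ?C" unfolding p_Suc[symmetric] by (rule p_in_segment) simp
    show "\<not> prefix (p i @ [s i]) v" if "v \<in> ?B" for v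
      using strip_part_off_ray[OF that] by (simp add: p_Suc)
    show "prefix (p i @ [s i]) v" if "v \<in> ?C" for v
      using segment_prefix[OF that] by (simp only: p_Suc)
  qed (use A01 finite_strip_part finite_segment in blast)+
  moreover have B: "0 < real (rooted A ?B (p i) a)"
      "\<bar>ln (real (rooted A ?B (p i) a)) - h * real (card ?B)\<bar>
        \<le> \<epsilon> * real (card ?B) + (ln (real CARD('k)) + \<bar>h\<bar>)"
    using rooted_strip_part_close[OF \<epsilon> close] by blast+
  moreover have S: "0 < ?S"
      "\<bar>ln ?S - h * real (card ?C)\<bar> \<le> (\<epsilon> * real (card ?C) + real (Suc d) * ?K) + ln (real CARD('k))"
    using Suc.IH[of "Suc i"] succs_nonempty[of a]
    by (intro ln_sum_close; force intro: card_mono)+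
  ultimately have r: "real (rooted A (segment n i (i + Suc (Suc d))) (p i) a) = real (rooted A ?B (p i) a) * ?S"
    unfolding seg by blast
  have "ln (real (rooted A ?B (p i) a) * ?S) = ln (real (rooted A ?B (p i) a)) + ln ?S"
    using B(1) S(1) by (rule ln_mult_pos)
  moreover have "h * real (card ?B + card ?C) = h * real (card ?B) + h * real (card ?C)"
    "\<epsilon> * real (card ?B + card ?C) = \<epsilon> * real (card ?B) + \<epsilon> * real (card ?C)"
    "real (Suc (Suc d)) * ?K = real (Suc d) * ?K + ?K"
    by (simp_all add: algebra_simps)
  ultimately have "\<bar>ln (real (rooted A ?B (p i) a) * ?S) - h * real (card ?B + card ?C)\<bar>
      \<le> \<epsilon> * real (card ?B + card ?C) + real (Suc (Suc d)) * ?K"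
    using B(2) S(2) by linarith
  then show ?case
    unfolding r card using mult_pos_pos[OF B(1) S(1)] by blast
qed

lemma strip_eq_segment: "strip (n + 2) m p = segment n 0 m"
  by (simp add: strip_def segment_def atLeast0LessThan)

lemma card_patterns_strip:
  assumes "0 < m"
  shows "real (card (patterns (strip (n + 2) m p) (tree_shift A)))
    = (\<Sum>a\<in>UNIV. real (rooted A (segment n 0 m) (p 0) a))"
  unfolding strip_eq_segment p_0
proof (rule card_patterns)
  show "segment n 0 m \<subseteq> golden_tree"
    using strip_part_tree by (fastforce simp: segment_def)
  show "[] \<in> segment n 0 m" using p_in_segment[OF assms] by (simp add: p_0)
  show "finite (segment n 0 m)" by (rule finite_segment)
  show "w \<in> segment n 0 m" if wf: "w @ [f] \<in> segment n 0 m" for w f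
  proof -
    obtain j where j: "j < m" "w @ [f] = p j \<or> w @ [f] \<in> subtree n (side_root j)"
      using wf unfolding segment_def strip_part_eq by auto
    then show ?thesis
    proof (elim disjE)
      assume "w @ [f] = p j"
      then obtain i where "j = Suc i" "w = p i"
        by (cases j) (auto simp: p_0 p_Suc)
      then show ?thesis using j(1) p_in_strip_part[of i n] by (auto simp: segment_def)
    next
      assume v: "w @ [f] \<in> subtree n (side_root j)"
      then have "w = p j \<or> w \<in> subtree n (side_root j)"
        by (auto simp: subtree_def golden_tree_snoc prefix_snoc)
      then have "w \<in> strip_part (n + 2) p j" unfolding strip_part_eq by blast
      then show ?thesis using j(1) by (auto simp: segment_def)
    qed
  qed
qed

text \<open>
  The bound does not depend on \<open>m\<close>, which makes it survive the upper limit in the strip entropy.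
\<close>
lemma strip_ratio_close:
  assumes \<epsilon>: "\<epsilon> > 0"
    and close: "\<And>f a. \<bar>ln (branch_count A n f a) - h * real (branch_size n f)\<bar>
      \<le> \<epsilon> * real (branch_size n f)"
    and m: "0 < m"
  shows "\<bar>ln (real (card (patterns (strip (n + 2) m p) (tree_shift A))))
      / real (card (strip (n + 2) m p)) - h\<bar>
    \<le> \<epsilon> + 2 * (3 * ln (real CARD('k)) + \<bar>h\<bar>) / real (n + 1)"
proof -
  define c where "c = real (card (segment n 0 m))"
  define N where "N = (\<Sum>a\<in>UNIV. real (rooted A (segment n 0 m) (p 0) a))"
  \<comment> \<open>the third logarithm absorbs the sum over the label of the root, as \<open>m \<ge> 1\<close>\<close>
  define K where "K = 3 * ln (real CARD('k)) + \<bar>h\<bar>"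
  have lnk: "0 \<le> ln (real CARD('k))" using k_ge_1 by simp
  then have K: "0 \<le> K" by (simp add: K_def)
  obtain d where d: "m = 0 + Suc d" using m by (cases m) auto
  have "\<bar>ln N - h * c\<bar>
      \<le> (\<epsilon> * c + real m * (2 * ln (real CARD('k)) + \<bar>h\<bar>)) + ln (real CARD('k))"
    unfolding N_def c_def d using rooted_segment_close[OF \<epsilon> close, of 0 d]
    by (intro ln_sum_close(2)) auto
  also have "\<dots> \<le> \<epsilon> * c + real m * K"
  proof -
    have "1 * ln (real CARD('k)) \<le> real m * ln (real CARD('k))"
      using m lnk by (intro mult_right_mono) auto
    then show ?thesis by (simp add: K_def algebra_simps)
  qed
  finally have *: "\<bar>ln N - h * c\<bar> \<le> \<epsilon> * c + real m * K" .
  have "(n + 1) * m \<le> 2 * card (segment n 0 m)"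
    using segment_large[of n m 0] by (simp add: p_0 node_type_def)
  then have mc: "real (n + 1) * real m \<le> 2 * c"
    unfolding c_def by (metis of_nat_le_iff of_nat_mult of_nat_numeral)
  moreover have "0 < real (n + 1) * real m" using m by simp
  ultimately have c: "0 < c" by linarith
  have "real m * K \<le> (2 * K / real (n + 1)) * c"
  proof -
    have "real m \<le> 2 * c / real (n + 1)" using mc by (simp add: le_divide_eq mult.commute)
    then have "real m * K \<le> 2 * c / real (n + 1) * K" using K by (rule mult_right_mono)
    then show ?thesis by (simp add: ac_simps)
  qed
  with * have "\<bar>ln N - h * c\<bar> \<le> (\<epsilon> + 2 * K / real (n + 1)) * c"
    by (simp add: distrib_right)
  moreover have "\<bar>ln N / c - h\<bar> = \<bar>ln N - h * c\<bar> / c"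
  proof -
    have "ln N / c - h = (ln N - h * c) / c" using c by (simp add: diff_divide_distrib)
    then show ?thesis using c by simp
  qed
  ultimately have "\<bar>ln N / c - h\<bar> \<le> \<epsilon> + 2 * K / real (n + 1)"
    using c by (simp add: divide_le_eq)
  then show ?thesis
    unfolding card_patterns_strip[OF m] unfolding strip_eq_segment N_def c_def K_def .
qed

lemma strip_entropy_close:
  assumes "\<epsilon> > 0"
    and "\<And>f a. \<bar>ln (branch_count A n f a) - h * real (branch_size n f)\<bar>
      \<le> \<epsilon> * real (branch_size n f)"
    and \<delta>: "\<epsilon> + 2 * (3 * ln (real CARD('k)) + \<bar>h\<bar>) / real (n + 1) \<le> \<delta>"
  shows "ereal (h - \<delta>) \<le> strip_entropy (n + 2) (tree_shift A) p"
    and "strip_entropy (n + 2) (tree_shift A) p \<le> ereal (h + \<delta>)"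
proof -
  let ?r = "\<lambda>m. ln (real (card (patterns (strip (n + 2) m p) (tree_shift A))))
    / real (card (strip (n + 2) m p))"
  have "\<bar>?r m - h\<bar> \<le> \<delta>" if "0 < m" for m
    using strip_ratio_close[OF assms(1,2) that] \<delta> by (rule order_trans)
  then have "h - \<delta> \<le> ?r m \<and> ?r m \<le> h + \<delta>" if "0 < m" for m
    using that by (simp only: abs_le_iff diff_le_eq minus_diff_eq le_diff_eq add.commute)
  then have ev: "eventually (\<lambda>m. ereal (h - \<delta>) \<le> ereal (?r m)) sequentially"
      "eventually (\<lambda>m. ereal (?r m) \<le> ereal (h + \<delta>)) sequentially"
    by (auto intro!: eventually_sequentiallyI[of 1])
  show "ereal (h - \<delta>) \<le> strip_entropy (n + 2) (tree_shift A) p"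
    unfolding strip_entropy_def using ev(1) by (intro le_Limsup) auto
  show "strip_entropy (n + 2) (tree_shift A) p \<le> ereal (h + \<delta>)"
    unfolding strip_entropy_def using ev(2) by (rule Limsup_bounded)
qed

lemma strip_entropy_tendsto:
  assumes h: "\<And>f a. (\<lambda>n. ln (branch_count A n f a) / real (branch_size n f)) \<longlonglongrightarrow> h"
  shows "(\<lambda>n. strip_entropy n (tree_shift A) p) \<longlonglongrightarrow> ereal h"
proof (rule LIMSEQ_offset[where k = 2])
  have ev: "eventually (\<lambda>n. ereal (h - \<delta>) \<le> strip_entropy (n + 2) (tree_shift A) p
      \<and> strip_entropy (n + 2) (tree_shift A) p \<le> ereal (h + \<delta>)) sequentially" if \<delta>: "\<delta> > 0" for \<delta>
  proof -
    have "(\<lambda>n. 2 * (3 * ln (real CARD('k)) + \<bar>h\<bar>) / real (n + 1)) \<longlonglongrightarrow> 0"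
      by real_asymp
    then have "eventually (\<lambda>n. 2 * (3 * ln (real CARD('k)) + \<bar>h\<bar>) / real (n + 1) < \<delta> / 2) sequentially"
      using \<delta> by (intro order_tendstoD(2)) auto
    moreover have "eventually (\<lambda>n. \<forall>f a. \<bar>ln (branch_count A n f a) - h * real (branch_size n f)\<bar>
        \<le> \<delta> / 2 * real (branch_size n f)) sequentially"
      using \<delta> by (intro branch_entropy_uniform h) auto
    ultimately show ?thesis
    proof eventually_elim
      fix n
      assume n: "2 * (3 * ln (real CARD('k)) + \<bar>h\<bar>) / real (n + 1) < \<delta> / 2"
        and close: "\<forall>f a. \<bar>ln (branch_count A n f a) - h * real (branch_size n f)\<bar>
          \<le> \<delta> / 2 * real (branch_size n f)"
      have "\<delta> / 2 + 2 * (3 * ln (real CARD('k)) + \<bar>h\<bar>) / real (n + 1) \<le> \<delta>"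
        using n by linarith
      from strip_entropy_close[OF _ _ this] close \<delta>
      show "ereal (h - \<delta>) \<le> strip_entropy (n + 2) (tree_shift A) p
          \<and> strip_entropy (n + 2) (tree_shift A) p \<le> ereal (h + \<delta>)" by auto
    qed
  qed
  show "(\<lambda>n. strip_entropy (n + 2) (tree_shift A) p) \<longlonglongrightarrow> ereal h"
  proof (rule order_tendstoI)
    fix l assume "l < ereal h"
    then obtain x where x: "l < ereal x" "x < h" using ereal_dense2 by force
    show "eventually (\<lambda>n. l < strip_entropy (n + 2) (tree_shift A) p) sequentially"
      using ev[of "h - x"] x by (auto elim!: eventually_mono intro: less_le_trans)
  next
    fix u assume "ereal h < u"
    then obtain x where x: "ereal x < u" "h < x" using ereal_dense2 by force
    show "eventually (\<lambda>n. strip_entropy (n + 2) (tree_shift A) p < u) sequentially"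
      using ev[of "x - h"] x by (auto elim!: eventually_mono intro: le_less_trans)
  qed
qed

end

theorem theorem1:
  fixes A :: "real ^ 'k ^ 'k" and p :: "nat \<Rightarrow> 2 list"
  assumes "\<forall>i j. A $ i $ j \<in> {0, 1}"
    and "primitive_matrix A"
    and "p \<in> rays"
  shows "(\<lambda>n. strip_entropy n (tree_shift A) p) \<longlonglongrightarrow> ereal (entropy (tree_shift A))"
proof -
  obtain s where p: "p 0 = []" "\<And>j. p (Suc j) = p j @ [s j]" "\<And>j. p j \<in> golden_tree"
      "\<And>j. length (p j) = j"
    using rays_cases[OF assms(3)] by metis
  interpret ray_strip A p s
    by unfold_locales (use assms p in auto)
  obtain h where h: "\<And>f a. (\<lambda>n. ln (branch_count A n f a) / real (branch_size n f)) \<longlonglongrightarrow> h"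
    using branch_entropy by metis
  show ?thesis
    unfolding entropy_eq[OF h] by (rule strip_entropy_tendsto[OF h])
qed

end
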